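(* Let $n$ be a positive integer and $k$ a nonnegative integer with $n \ge k$. If $G$ has girth at least $5$ and has $n-k$ vertices of degree at least $D$ and $k$ vertices of degree less than $D$, with $D > k$, then $$c(G) \ge D-k.$$
   Context: All graphs are finite, simple, undirected and connected; $G$ is a graph (of order $n$). The girth of a graph is the length of its shortest cycle. Cops and Robbers on a graph $G$: in round $0$ the cops choose vertices to occupy, then the robber chooses a vertex. In each later round the cops move first and then the robber. On a move, each player moves to a neighboring vertex or stays put; any subset of the cops may move. The cops win if after finitely many rounds some cop occupies the robber's vertex; otherwise the robber wins. The cop number $c(G)$ is the minimum number of cops required to guarantee a win for the cops.
   Formalization: The case k = n (no vertex of degree at least D) is excluded; there the claim fails, e.g. for the 5-cycle with n = k = 5 and D = 100 it would give cop number at least 95, while it is 2. *)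

theory Defs
  imports "Graph_Theory.Graph_Theory" "HOL-Library.Extended_Nat"
begin

text \<open>
  A simple undirected graph is a \<^locale>\<open>graph\<close>: a finite symmetric digraph without loops and
  multiple arcs. Every undirected edge is a pair of opposite arcs, so \<^const>\<open>out_degree\<close> is the degree.
\<close>

text \<open>
  \<^const>\<open>pre_digraph.cycle\<close> admits the closed walk along an edge and back, which is not a cycle of the
  undirected graph; hence the restriction to length at least 3. An acyclic graph has girth \<open>\<infinity>\<close>.
\<close>

definition girth :: "('a, 'b) pre_digraph \<Rightarrow> enat" where
  "girth G = (INF p \<in> {p. pre_digraph.cycle G p \<and> 3 \<le> length p}. enat (length p))"

definition legal_move :: "('a, 'b) pre_digraph \<Rightarrow> 'a \<Rightarrow> 'a \<Rightarrow> bool" where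
  "legal_move G u v \<longleftrightarrow> u \<in> verts G \<and> (v = u \<or> u \<rightarrow>\<^bsub>G\<^esub> v)"

text \<open>\<open>r t\<close> is the robber's vertex at the end of round \<open>t\<close>.\<close>

definition robber_play :: "('a, 'b) pre_digraph \<Rightarrow> (nat \<Rightarrow> 'a) \<Rightarrow> bool" where
  "robber_play G r \<longleftrightarrow> r 0 \<in> verts G \<and> (\<forall>t. legal_move G (r t) (r (Suc t)))"

text \<open>
  A strategy for cops \<open>0, \<dots>, m - 1\<close> may depend on the whole history of the robber:
  \<open>s [r 0, \<dots>, r (t - 1)] i\<close> is the vertex of cop \<open>i\<close> after the cops' turn in round \<open>t\<close>. In particular,
  \<open>s []\<close> is the initial placement. The cops' own history is determined by \<open>s\<close>.
\<close>

definition cop_strategy :: "('a, 'b) pre_digraph \<Rightarrow> nat \<Rightarrow> ('a list \<Rightarrow> nat \<Rightarrow> 'a) \<Rightarrow> bool" where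
  "cop_strategy G m s \<longleftrightarrow>
     (\<forall>i<m. s [] i \<in> verts G) \<and>
     (\<forall>r t. robber_play G r \<longrightarrow>
        (\<forall>i<m. legal_move G (s (map r [0..<t]) i) (s (map r [0..<Suc t]) i)))"

text \<open>
  While the robber is at \<open>r t\<close>, the cops are first where they stood after their turn in round \<open>t\<close>, and
  then where they move in round \<open>t + 1\<close>. What happens after a capture is irrelevant.
\<close>

definition captures :: "nat \<Rightarrow> ('a list \<Rightarrow> nat \<Rightarrow> 'a) \<Rightarrow> (nat \<Rightarrow> 'a) \<Rightarrow> bool" where
  "captures m s r \<longleftrightarrow>
     (\<exists>t. \<exists>i<m. s (map r [0..<t]) i = r t \<or> s (map r [0..<Suc t]) i = r t)"

definition cops_win :: "('a, 'b) pre_digraph \<Rightarrow> nat \<Rightarrow> bool" where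
  "cops_win G m \<longleftrightarrow>
     (\<exists>s. cop_strategy G m s \<and> (\<forall>r. robber_play G r \<longrightarrow> captures m s r))"

definition cop_number :: "('a, 'b) pre_digraph \<Rightarrow> nat" where
  "cop_number G = (LEAST m. cops_win G m)"

text \<open>The minimum is over a nonempty set: a cop on every vertex wins at once.\<close>

lemma cops_win_card_verts:
  assumes "finite (verts G)"
  shows "cops_win G (card (verts G))"
proof -
  obtain f where f: "bij_betw f {0..<card (verts G)} (verts G)"
    using ex_bij_betw_nat_finite[OF assms] by blast
  then have in_verts: "f i \<in> verts G" if "i < card (verts G)" for i
    using that by (auto simp: bij_betw_def)
  have "cop_strategy G (card (verts G)) (\<lambda>_. f)"
    by (simp add: cop_strategy_def legal_move_def in_verts)
  moreover have "captures (card (verts G)) (\<lambda>_. f) r" if "robber_play G r" for r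
  proof -
    have "r 0 \<in> f ` {0..<card (verts G)}"
      using that f by (simp add: robber_play_def bij_betw_def)
    then obtain i where "i < card (verts G)" "f i = r 0"
      by auto
    then show ?thesis
      unfolding captures_def by blast
  qed
  ultimately show ?thesis
    by (auto simp: cops_win_def)
qed

lemma cops_win_cop_number:
  assumes "finite (verts G)"
  shows "cops_win G (cop_number G)"
  unfolding cop_number_def using cops_win_card_verts[OF assms] by (rule LeastI)

end

theory Submission
  imports Defs
begin

text \<open>
  This is the argument of Aigner and Fromme, relativised to a set of vertices. The robber never
  leaves the set \<open>A\<close> of vertices of degree at least \<open>D\<close>. Only \<open>k\<close> vertices lie outside \<open>A\<close>, so every
  vertex of \<open>A\<close> has at least \<open>D - k\<close> neighbours inside \<open>A\<close>. A cop who is not on the robber's vertex \<open>r\<close>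
  guards (occupies or is adjacent to) at most one neighbour of \<open>r\<close>: two guarded neighbours would close
  a triangle or a 4-cycle through \<open>r\<close>, which girth at least 5 forbids
  (\<open>cop_guards_at_most_one_neighbour\<close>). Hence fewer than \<open>D - k\<close> cops always leave the robber some
  neighbour in \<open>A\<close> that no cop guards. After moving there he cannot be caught in the cops' next turn,
  and he is again in the position to move on (\<open>evasion\<close>).
\<close>

lemma (in pre_digraph) length_cycle_ge_girth:
  assumes "girth G \<ge> enat g" and "cycle p" and "3 \<le> length p"
  shows "g \<le> length p"
proof -
  have "girth G \<le> enat (length p)"
    unfolding girth_def using assms(2,3) by (auto intro!: INF_lower2[of p])
  with assms(1) have "enat g \<le> enat (length p)"
    by (rule order_trans)
  then show ?thesis by simp
qed

lemma (in loopfree_digraph) not_dominates_self: "\<not> u \<rightarrow> u"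
  using no_loops by (auto simp: arcs_ends_conv)

lemma (in wf_digraph) no_triangle:
  assumes girth: "girth G \<ge> 5"
    and "u \<rightarrow> v" "v \<rightarrow> w" "w \<rightarrow> u" and "distinct [u, v, w]"
  shows False
proof -
  obtain e f g where "e \<in> arcs G" "f \<in> arcs G" "g \<in> arcs G"
    and "tail G e = u" "head G e = v" "tail G f = v" "head G f = w" "tail G g = w" "head G g = u"
    using assms(2-4) by (auto simp: arcs_ends_conv)
  then have "cycle [e, f, g]"
    using assms(5) unfolding cycle_def by (intro exI[of _ u]) (auto simp: awalk_simps)
  moreover have "girth G \<ge> enat 5"
    using girth by (simp add: numeral_eq_enat)
  ultimately show False
    using length_cycle_ge_girth[of 5 "[e, f, g]"] by simp
qed

lemma (in wf_digraph) no_four_cycle: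
  assumes girth: "girth G \<ge> 5"
    and "u \<rightarrow> v" "v \<rightarrow> w" "w \<rightarrow> x" "x \<rightarrow> u" and "distinct [u, v, w, x]"
  shows False
proof -
  obtain e f g h where "e \<in> arcs G" "f \<in> arcs G" "g \<in> arcs G" "h \<in> arcs G"
    and "tail G e = u" "head G e = v" "tail G f = v" "head G f = w"
      "tail G g = w" "head G g = x" "tail G h = x" "head G h = u"
    using assms(2-5) by (auto simp: arcs_ends_conv)
  then have "cycle [e, f, g, h]"
    using assms(6) unfolding cycle_def by (intro exI[of _ u]) (auto simp: awalk_simps)
  moreover have "girth G \<ge> enat 5"
    using girth by (simp add: numeral_eq_enat)
  ultimately show False
    using length_cycle_ge_girth[of 5 "[e, f, g, h]"] by simp
qed

definition guards :: "('a, 'b) pre_digraph \<Rightarrow> 'a \<Rightarrow> 'a \<Rightarrow> bool" where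
  "guards G c v \<longleftrightarrow> c = v \<or> c \<rightarrow>\<^bsub>G\<^esub> v"

text \<open>
  If the cop stands on one of the two guarded neighbours, the three vertices \<open>r\<close>, \<open>v\<close>, \<open>w\<close> form a
  triangle; otherwise \<open>r\<close>, \<open>v\<close>, \<open>c\<close>, \<open>w\<close> form a 4-cycle.
\<close>

lemma (in graph) cop_guards_at_most_one_neighbour:
  assumes girth: "girth G \<ge> 5" and "c \<noteq> r"
    and v: "r \<rightarrow> v" "guards G c v" and w: "r \<rightarrow> w" "guards G c w"
  shows "v = w"
proof (rule ccontr)
  assume "v \<noteq> w"
  have sym: "x \<rightarrow> y" if "y \<rightarrow> x" for x y
    using arcs_ends_symmetric[OF sym_arcs that] .
  have "r \<noteq> v" "r \<noteq> w"
    using v w not_dominates_self by auto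
  consider "c = v" | "c = w" | "c \<noteq> v" "c \<noteq> w"
    by blast
  then show False
  proof cases
    case 1
    then have "v \<rightarrow> w" using w \<open>v \<noteq> w\<close> by (auto simp: guards_def)
    then show False
      using no_triangle[OF girth, of r v w] sym v w \<open>v \<noteq> w\<close> \<open>r \<noteq> v\<close> \<open>r \<noteq> w\<close> by auto
  next
    case 2
    then have "w \<rightarrow> v" using v \<open>v \<noteq> w\<close> by (auto simp: guards_def)
    then show False
      using no_triangle[OF girth, of r v w] sym v w \<open>v \<noteq> w\<close> \<open>r \<noteq> v\<close> \<open>r \<noteq> w\<close> by auto
  next
    case 3
    then have "c \<rightarrow> v" "c \<rightarrow> w" using v w by (auto simp: guards_def)
    then show False
      using no_four_cycle[OF girth, of r v c w] sym v w 3 \<open>c \<noteq> r\<close> \<open>v \<noteq> w\<close> \<open>r \<noteq> v\<close> \<open>r \<noteq> w\<close>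
      by auto
  qed
qed

text \<open>
  If every vertex of \<open>X\<close> had a guard, a choice of guards would be an injection from \<open>X\<close> into \<open>C\<close>,
  because no cop guards two neighbours of \<open>r\<close>.
\<close>

lemma (in graph) unguarded_neighbour:
  assumes girth: "girth G \<ge> 5" and "finite C" and "r \<notin> C"
    and nbrs: "\<And>w. w \<in> X \<Longrightarrow> r \<rightarrow> w" and card: "card C < card X"
  shows "\<exists>w\<in>X. \<forall>c\<in>C. \<not> guards G c w"
proof (rule ccontr)
  assume "\<not> ?thesis"
  then obtain g where g: "\<And>w. w \<in> X \<Longrightarrow> g w \<in> C \<and> guards G (g w) w"
    by metis
  have "inj_on g X"
  proof (rule inj_onI)
    fix v w assume "v \<in> X" "w \<in> X" "g v = g w"
    with g[of v] g[of w] nbrs \<open>r \<notin> C\<close> show "v = w"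
      using cop_guards_at_most_one_neighbour[OF girth, of "g v" r v w] by metis
  qed
  then have "card X \<le> card C"
    using g \<open>finite C\<close> by (intro card_inj_on_le[of g]) auto
  with card show False by simp
qed

text \<open>
  The cops' strategy answers the robber's history, and the robber in turn answers the cops' placement;
  since that placement is a function of the history, his play unfolds from a rule on histories.
\<close>

lemma ex_play_of_history_rule: "\<exists>r. \<forall>t. r t = f (map r [0..<t])"
proof -
  define hist where "hist = rec_nat [] (\<lambda>_ h. h @ [f h])"
  define r where "r t = f (hist t)" for t
  have "hist t = map r [0..<t]" for t
    by (induction t) (simp_all add: hist_def r_def)
  then show ?thesis
    unfolding r_def by metis
qed

text \<open>
  The invariant is that after each of his turns the robber is in \<open>A\<close> and unguarded. The cops' legal
  moves then cannot reach him, so no cop shares his vertex when he looks for his next unguarded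
  neighbour.
\<close>

lemma (in graph) evasion:
  assumes girth: "girth G \<ge> 5"
    and A: "A \<subseteq> verts G" "A \<noteq> {}"
    and degree: "\<And>v. v \<in> A \<Longrightarrow> m < card {w \<in> A. v \<rightarrow> w}"
  shows "\<not> cops_win G m"
proof
  assume "cops_win G m"
  then obtain s where strategy: "cop_strategy G m s"
    and wins: "\<And>r. robber_play G r \<Longrightarrow> captures m s r"
    by (auto simp: cops_win_def)
  define C where "C h = s h ` {..<m}" for h
  define safe where "safe h w \<longleftrightarrow> w \<in> A \<and> (\<forall>c\<in>C h. \<not> guards G c w)" for h w
  have "finite (C h)" and card_C: "card (C h) \<le> m" for h
    using card_image_le[of "{..<m}" "s h"] by (auto simp: C_def)
  have "finite A"
    using A(1) finite_verts by (rule finite_subset)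
  have escape: "\<exists>w. v \<rightarrow> w \<and> safe h w" if "v \<in> A" "v \<notin> C h" for v h
    using unguarded_neighbour[OF girth \<open>finite (C h)\<close> \<open>v \<notin> C h\<close>, of "{w \<in> A. v \<rightarrow> w}"]
      degree[OF \<open>v \<in> A\<close>] card_C[of h] by (auto simp: safe_def)
  \<comment> \<open>The cops cannot occupy all of \<open>A\<close>. From an unoccupied vertex of \<open>A\<close> the robber could step to a
      safe neighbour; he starts on that neighbour.\<close>
  have start: "\<exists>w. safe [] w"
  proof -
    obtain a where "a \<in> A" using A by blast
    have "m < card {w \<in> A. a \<rightarrow> w}" using degree \<open>a \<in> A\<close> .
    also have "\<dots> \<le> card A" using \<open>finite A\<close> by (intro card_mono) auto
    finally have "\<not> A \<subseteq> C []"
      using card_C[of "[]"] card_mono[OF \<open>finite (C [])\<close>, of A] by linarith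
    then show ?thesis using escape by blast
  qed
  \<comment> \<open>The legality of the cops' moves is only known against a complete legal play of the robber.
      Staying put when no safe neighbour exists makes his play legal before he is known to be safe.\<close>
  define f where "f h =
    (if h = [] then SOME w. safe [] w
     else if \<exists>w. last h \<rightarrow> w \<and> safe h w then SOME w. last h \<rightarrow> w \<and> safe h w
     else last h)" for h
  obtain r where r: "\<And>t. r t = f (map r [0..<t])"
    using ex_play_of_history_rule[of f] by blast
  have safe_0: "safe [] (r 0)"
    using someI_ex[OF start] r[of 0] by (simp add: f_def)
  define moves where "moves t w \<longleftrightarrow> r t \<rightarrow> w \<and> safe (map r [0..<Suc t]) w" for t w
  have r_Suc: "r (Suc t) = (if \<exists>w. moves t w then SOME w. moves t w else r t)" for t
    using r[of "Suc t"] by (simp add: f_def moves_def cong: if_cong)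
  have moves_r: "moves t (r (Suc t))" if "\<exists>w. moves t w" for t
    using someI_ex[OF that] that by (simp add: r_Suc)
  have step: "r (Suc t) = r t \<or> r t \<rightarrow> r (Suc t)" for t
  proof (cases "\<exists>w. moves t w")
    case True
    from moves_r[OF this] show ?thesis by (simp add: moves_def)
  next
    case False
    then show ?thesis by (simp add: r_Suc)
  qed
  have in_verts: "r t \<in> verts G" for t
  proof (induction t)
    case 0
    then show ?case using safe_0 A by (auto simp: safe_def)
  next
    case (Suc t)
    then show ?case using step[of t] by (auto simp: arcs_ends_conv)
  qed
  have play: "robber_play G r"
    unfolding robber_play_def legal_move_def using step in_verts by blast
  have not_caught: "r t \<notin> C (map r [0..<Suc t])" if "safe (map r [0..<t]) (r t)" for t
  proof
    assume "r t \<in> C (map r [0..<Suc t])"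
    then obtain i where "i < m" and i: "r t = s (map r [0..<Suc t]) i"
      unfolding C_def by blast
    have "legal_move G (s (map r [0..<t]) i) (r t)"
      unfolding i using strategy play \<open>i < m\<close> by (simp only: cop_strategy_def)
    then have "guards G (s (map r [0..<t]) i) (r t)"
      unfolding legal_move_def guards_def by metis
    moreover have "s (map r [0..<t]) i \<in> C (map r [0..<t])"
      unfolding C_def using \<open>i < m\<close> by simp
    ultimately show False
      using that unfolding safe_def by blast
  qed
  have always_safe: "safe (map r [0..<t]) (r t)" for t
  proof (induction t)
    case 0
    then show ?case using safe_0 by simp
  next
    case (Suc t)
    then have "r t \<in> A" by (simp add: safe_def)
    then have "\<exists>w. moves t w"
      using escape not_caught[OF Suc] unfolding moves_def by blast
    then show ?case
      using moves_r unfolding moves_def by blast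
  qed
  from wins[OF play] obtain t i where "i < m"
    and "s (map r [0..<t]) i = r t \<or> s (map r [0..<Suc t]) i = r t"
    unfolding captures_def by blast
  then have "r t \<in> C (map r [0..<t]) \<or> r t \<in> C (map r [0..<Suc t])"
    unfolding C_def by (metis imageI lessThan_iff)
  moreover have "r t \<notin> C (map r [0..<t])"
    using always_safe[of t] unfolding safe_def guards_def by blast
  ultimately show False
    using not_caught[OF always_safe] by blast
qed

lemma (in digraph) out_degree_eq_card_neighbours: "out_degree G v = card {w. v \<rightarrow> w}"
proof -
  have "inj_on (head G) (out_arcs G v)"
    using no_multi_arcs by (auto simp: inj_on_def arc_to_ends_def)
  moreover have "head G ` out_arcs G v = {w. v \<rightarrow> w}"
    by (auto simp: arcs_ends_conv)
  ultimately show ?thesis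
    unfolding out_degree_def by (metis card_image)
qed

theorem lemma3:
  fixes G :: "('a, 'b) pre_digraph" and n k D :: nat
  assumes "graph G" and "connected G" and "card (verts G) = n"
    and "n > 0" and "k \<le> n"
    and "k \<noteq> n"
    and "girth G \<ge> 5"
    and "card {v \<in> verts G. out_degree G v \<ge> D} = n - k"
    and "card {v \<in> verts G. out_degree G v < D} = k"
    and "D > k"
  shows "cop_number G \<ge> D - k"
proof (rule ccontr)
  assume few: "\<not> cop_number G \<ge> D - k"
  interpret graph G by fact
  let ?A = "{v \<in> verts G. out_degree G v \<ge> D}"
  let ?B = "{v \<in> verts G. out_degree G v < D}"
  have "card ?A > 0"
    using assms(5,6,8) by simp
  then have "?A \<noteq> {}"
    by (metis card.empty less_irrefl)
  have "cop_number G < card {w \<in> ?A. v \<rightarrow>\<^bsub>G\<^esub> w}" if "v \<in> ?A" for v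
  proof -
    have "{w. v \<rightarrow>\<^bsub>G\<^esub> w} \<subseteq> {w \<in> ?A. v \<rightarrow>\<^bsub>G\<^esub> w} \<union> ?B"
      by (auto simp: arcs_ends_conv)
    then have "card {w. v \<rightarrow>\<^bsub>G\<^esub> w} \<le> card ({w \<in> ?A. v \<rightarrow>\<^bsub>G\<^esub> w} \<union> ?B)"
      by (intro card_mono) auto
    also have "\<dots> \<le> card {w \<in> ?A. v \<rightarrow>\<^bsub>G\<^esub> w} + card ?B"
      by (rule card_Un_le)
    finally have "D \<le> card {w \<in> ?A. v \<rightarrow>\<^bsub>G\<^esub> w} + k"
      using that assms(9) out_degree_eq_card_neighbours[of v] by simp
    with few show ?thesis by linarith
  qed
  with \<open>?A \<noteq> {}\<close> have "\<not> cops_win G (cop_number G)"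
    using evasion[OF assms(7), of ?A "cop_number G"] by blast
  then show False
    using cops_win_cop_number[OF finite_verts] by contradiction
qed

end
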